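(* Let $\mathcal{M}$ be a simplicial surface in $\mathbb{R}^3$ with vertices $v_1,\dots,v_n$ and set of triangular faces $\mathcal{F}(\mathcal{M})$, and let $f:\mathcal{M}\to\mathbb{R}^2$ be a simplicial mapping with vertex images $\mathbf{f}_\ell=f(v_\ell)=(f_\ell^1,f_\ell^2)^\top$, such that $f(\tau)$ is a nondegenerate triangle for every $\tau\in\mathcal{F}(\mathcal{M})$. Put $\mathbf{f}^s=(f_1^s,\dots,f_n^s)^\top$ for $s=1,2$. Then the gradient of the stretch energy $E_S$, regarded as a function of the $2n$ variables $f_\ell^s$, is at $f$ equal to $$\nabla_{\mathbf{f}}E_S(f):=\begin{bmatrix}\nabla_{\mathbf{f}^1}E_S(f)\\ \nabla_{\mathbf{f}^2}E_S(f)\end{bmatrix}=\begin{bmatrix}L_S(f)\,\mathbf{f}^1+\mathbf{h}^1\\ L_S(f)\,\mathbf{f}^2+\mathbf{h}^2\end{bmatrix},$$ where $\mathbf{h}^1,\mathbf{h}^2\in\mathbb{R}^n$ have entries, for $i=1,\dots,n$, $$\mathbf{h}^1_i=\frac12\sum_{\tau=[v_i,v_j,v_k]\in N_{\mathcal{F}}(v_i)}\frac{|f(\tau)|}{|\tau|}(f_j^2-f_k^2),\qquad \mathbf{h}^2_i=\frac12\sum_{\tau=[v_i,v_j,v_k]\in N_{\mathcal{F}}(v_i)}\frac{|f(\tau)|}{|\tau|}(f_k^1-f_j^1).$$ Here $N_{\mathcal{F}}(v_i)$ is the set of triangular faces containing $v_i$, and in each summand the face is written as $[v_i,v_j,v_k]$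 with its vertices listed so that $(\mathbf{f}_i,\mathbf{f}_j,\mathbf{f}_k)$ is counterclockwise, i.e. $|f(\tau)|=\frac12(f_i^1f_j^2-f_j^1f_i^2+f_k^1f_i^2-f_i^1f_k^2+f_j^1f_k^2-f_k^1f_j^2)$.
   Context: A simplicial surface $\mathcal{M}$ is a finite simplicial 2-complex in $\mathbb{R}^3$ that is the union of its (nondegenerate) triangular faces $\tau=[v_i,v_j,v_k]$, with edge set $\mathcal{E}(\mathcal{M})$ and face set $\mathcal{F}(\mathcal{M})$. $|\cdot|$ applied to a triangle denotes its area. A simplicial mapping $f:\mathcal{M}\to\mathbb{R}^2$ is a map that is affine on each face, hence determined by its vertex images $\mathbf{f}_\ell=f(v_\ell)$. The stretch energy is $$E_S(f)=\frac12\left((\mathbf{f}^1)^\top L_S(f)\,\mathbf{f}^1+(\mathbf{f}^2)^\top L_S(f)\,\mathbf{f}^2\right),$$ where $L_S(f)$ is the $n\times n$ matrix with $$[L_S(f)]_{i,j}=-\frac12\sum_{[v_i,v_j,v_k]\in\mathcal{F}(\mathcal{M})}\frac{\cot(\theta_{i,j}^k(f))\,|f([v_i,v_j,v_k])|}{|[v_i,v_j,v_k]|}\quad\text{if }i\neq j,\ [v_i,v_j]\in\mathcal{E}(\mathcal{M})$$ (sum over the faces containing the edge $[v_i,v_j]$), $[L_S(f)]_{i,i}=-\sum_{\ell\ne i}[L_S(f)]_{i,\ell}$, and all other entries $0$. Here $\theta_{i,j}^k(f)\in(0,\pi)$ is the angle at $\mathbf{f}_k$, opposite the edge $[\mathbf{f}_i,\mathbf{f}_j]$,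 in the image triangle $[\mathbf{f}_i,\mathbf{f}_j,\mathbf{f}_k]$. *)

theory Defs
  imports "HOL-Analysis.Analysis"
begin

section \<open>Simplicial surfaces and simplicial mappings\<close>

definition vertices :: "(real^3) set set \<Rightarrow> (real^3) set" where
  "vertices M = {p. {p} \<in> M}"

definition edges :: "(real^3) set set \<Rightarrow> (real^3) set set" where
  "edges M = {\<epsilon> \<in> M. 1 simplex \<epsilon>}"

definition faces :: "(real^3) set set \<Rightarrow> (real^3) set set" where
  "faces M = {\<tau> \<in> M. 2 simplex \<tau>}"

definition simplicial_surface :: "(real^3) set set \<Rightarrow> bool" where
  "simplicial_surface M \<longleftrightarrow>
     simplicial_complex M \<and> (\<forall>\<sigma>\<in>M. aff_dim \<sigma> \<le> 2) \<and> \<Union>M = \<Union>(faces M)"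

definition simplicial_map :: "(real^3) set set \<Rightarrow> (real^3 \<Rightarrow> real^2) \<Rightarrow> bool" where
  "simplicial_map M f \<longleftrightarrow>
     (\<forall>\<tau>\<in>faces M. \<exists>g c. linear g \<and> (\<forall>p\<in>\<tau>. f p = g p + c))"

section \<open>Areas and angles of triangles\<close>

definition area3 :: "real^3 \<Rightarrow> real^3 \<Rightarrow> real^3 \<Rightarrow> real" where
  "area3 a b c = norm (cross3 (b - a) (c - a)) / 2"

definition area2 :: "real^2 \<Rightarrow> real^2 \<Rightarrow> real^2 \<Rightarrow> real" where
  "area2 a b c = measure lebesgue (convex hull {a, b, c})"

text \<open>The angle at \<open>c\<close> in the triangle with vertices \<open>a\<close>, \<open>b\<close>, \<open>c\<close>;
  it lies in the open interval from \<open>0\<close> to \<open>pi\<close> if the triangle is nondegenerate.\<close>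

definition angle_at :: "real^2 \<Rightarrow> real^2 \<Rightarrow> real^2 \<Rightarrow> real" where
  "angle_at c a b = arccos (((a - c) \<bullet> (b - c)) / (norm (a - c) * norm (b - c)))"

definition signed_area :: "real^2 \<Rightarrow> real^2 \<Rightarrow> real^2 \<Rightarrow> real" where
  "signed_area a b c =
     1/2 * (a$1 * b$2 - b$1 * a$2 + c$1 * a$2 - a$1 * c$2 + b$1 * c$2 - c$1 * b$2)"

text \<open>Meant for nondegenerate triangles only, where it says that the signed area is
  positive (see \<open>counterclockwise_iff\<close> below).\<close>

definition counterclockwise :: "real^2 \<Rightarrow> real^2 \<Rightarrow> real^2 \<Rightarrow> bool" where
  "counterclockwise a b c \<longleftrightarrow> area2 a b c = signed_area a b c"

section \<open>The stretch energy\<close>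

text \<open>A simplicial mapping is determined by its vertex images, which are passed around as the
  pair of coordinate vectors \<open>(f1, f2)\<close>, so that the stretch energy becomes a function of
  \<open>2n\<close> real variables. The vertices are listed by \<open>v\<close>, and \<open>n\<close> is the cardinality of the
  index type.\<close>

definition coords :: "('n::finite \<Rightarrow> real^3) \<Rightarrow> (real^3 \<Rightarrow> real^2) \<Rightarrow> (real^'n) \<times> (real^'n)" where
  "coords v f = ((\<chi> l. f (v l) $ 1), (\<chi> l. f (v l) $ 2))"

definition vimg :: "(real^'n::finite) \<times> (real^'n) \<Rightarrow> 'n \<Rightarrow> real^2" where
  "vimg F l = vector [fst F $ l, snd F $ l]"

definition is_face :: "(real^3) set set \<Rightarrow> ('n::finite \<Rightarrow> real^3) \<Rightarrow> 'n \<Rightarrow> 'n \<Rightarrow> 'n \<Rightarrow> bool" where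
  "is_face M v i j k \<longleftrightarrow> convex hull {v i, v j, v k} \<in> faces M"

text \<open>The ratio of the area of the image of a face to the area of the face.\<close>

definition stretch ::
    "('n::finite \<Rightarrow> real^3) \<Rightarrow> (real^'n) \<times> (real^'n) \<Rightarrow> 'n \<Rightarrow> 'n \<Rightarrow> 'n \<Rightarrow> real" where
  "stretch v F i j k =
     area2 (vimg F i) (vimg F j) (vimg F k) / area3 (v i) (v j) (v k)"

definition stretch_weight ::
    "(real^3) set set \<Rightarrow> ('n::finite \<Rightarrow> real^3) \<Rightarrow> (real^'n) \<times> (real^'n) \<Rightarrow> 'n \<Rightarrow> 'n \<Rightarrow> real" where
  "stretch_weight M v F i j =
     (if i \<noteq> j \<and> convex hull {v i, v j} \<in> edges M
      then - (1/2) * (\<Sum>k | is_face M v i j k.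
              cot (angle_at (vimg F k) (vimg F i) (vimg F j)) * stretch v F i j k)
      else 0)"

definition stretch_laplacian ::
    "(real^3) set set \<Rightarrow> ('n::finite \<Rightarrow> real^3) \<Rightarrow> (real^'n) \<times> (real^'n) \<Rightarrow> real^'n^'n" where
  "stretch_laplacian M v F =
     (\<chi> i j. if i = j then - (\<Sum>l\<in>UNIV - {i}. stretch_weight M v F i l)
            else stretch_weight M v F i j)"

definition stretch_energy ::
    "(real^3) set set \<Rightarrow> ('n::finite \<Rightarrow> real^3) \<Rightarrow> (real^'n) \<times> (real^'n) \<Rightarrow> real" where
  "stretch_energy M v F =
     1/2 * (fst F \<bullet> (stretch_laplacian M v F *v fst F)
          + snd F \<bullet> (stretch_laplacian M v F *v snd F))"

text \<open>Each face containing \<open>v i\<close> whose image is nondegenerate contributes exactly one pair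
  \<open>(j, k)\<close> to these sums.\<close>

definition h1 ::
    "(real^3) set set \<Rightarrow> ('n::finite \<Rightarrow> real^3) \<Rightarrow> (real^'n) \<times> (real^'n) \<Rightarrow> real^'n" where
  "h1 M v F = (\<chi> i. 1/2 *
     (\<Sum>(j, k) | is_face M v i j k \<and> counterclockwise (vimg F i) (vimg F j) (vimg F k).
        stretch v F i j k * (snd F $ j - snd F $ k)))"

definition h2 ::
    "(real^3) set set \<Rightarrow> ('n::finite \<Rightarrow> real^3) \<Rightarrow> (real^'n) \<times> (real^'n) \<Rightarrow> real^'n" where
  "h2 M v F = (\<chi> i. 1/2 *
     (\<Sum>(j, k) | is_face M v i j k \<and> counterclockwise (vimg F i) (vimg F j) (vimg F k).
        stretch v F i j k * (fst F $ k - fst F $ j)))"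

section \<open>Consistency of the encoding\<close>

lemma vimg_coords: "vimg (coords v f) l = f (v l)"
  by (simp add: vimg_def coords_def vec_eq_iff forall_2)

text \<open>The area of the image triangle used above is the area of the image of the face.\<close>

lemma simplicial_map_image_face:
  assumes f: "simplicial_map M f" and "is_face M v i j k"
  shows "f ` (convex hull {v i, v j, v k}) = convex hull {f (v i), f (v j), f (v k)}"
proof -
  let ?T = "convex hull {v i, v j, v k}"
  obtain g c where g: "linear g" and fg: "\<forall>p\<in>?T. f p = g p + c"
    using assms unfolding simplicial_map_def is_face_def by blast
  have v: "v i \<in> ?T" "v j \<in> ?T" "v k \<in> ?T"
    by (simp_all add: hull_inc)
  have "f ` ?T = (+) c ` (g ` ?T)"
    using fg by (auto simp: image_iff add.commute)
  also have "\<dots> = (+) c ` (convex hull {g (v i), g (v j), g (v k)})"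
    using convex_hull_linear_image[OF g, of "{v i, v j, v k}"] by simp
  also have "\<dots> = convex hull ((+) c ` {g (v i), g (v j), g (v k)})"
    using convex_hull_translation[of c "{g (v i), g (v j), g (v k)}"] by simp
  also have "\<dots> = convex hull {f (v i), f (v j), f (v k)}"
    using fg v by (simp add: add.commute)
  finally show ?thesis .
qed

lemma area2_eq_abs_signed_area: "area2 a b c = \<bar>signed_area a b c\<bar>"
proof -
  have "convex hull {a, b, c} \<in> sets borel"
    by (simp add: borel_closed compact_convex_hull compact_imp_closed finite_imp_compact)
  then have "area2 a b c =
      \<bar>(c $ 1 - a $ 1) * (b $ 2 - a $ 2) - (b $ 1 - a $ 1) * (c $ 2 - a $ 2)\<bar> / 2"
    by (simp add: area2_def content_triangle)
  also have "(c $ 1 - a $ 1) * (b $ 2 - a $ 2) - (b $ 1 - a $ 1) * (c $ 2 - a $ 2) =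
      - 2 * signed_area a b c"
    by (simp add: signed_area_def algebra_simps)
  finally show ?thesis
    by (simp add: abs_mult)
qed

lemma counterclockwise_iff:
  "area2 a b c \<noteq> 0 \<Longrightarrow> counterclockwise a b c \<longleftrightarrow> signed_area a b c > 0"
  by (auto simp: counterclockwise_def area2_eq_abs_signed_area)

end

theory Submission
  imports Defs
begin

text \<open>
  In a triangle of area \<open>A\<close>, the cotangents of the angles, weighted by the squared lengths of the
  opposite edges, add up to \<open>4A\<close>. Hence the stretch energy is the sum of \<open>|f(\<tau>)|\<^sup>2 / |\<tau>|\<close> over the
  faces, a polynomial in the vertex images, and its gradient is the sum of
  \<open>2 |f(\<tau>)| / |\<tau>|\<close> times the gradient of \<open>|f(\<tau>)|\<close>. The gradient of the area with respect to a
  vertex can be written either as half the opposite edge rotated by a right angle or, by the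
  cotangent formula, as a combination of the two adjacent edges. The former writes half of
  the gradient of the energy as \<open>(h\<^sup>1, h\<^sup>2)\<close>, the latter as \<open>(L\<^sub>S f\<^sup>1, L\<^sub>S f\<^sup>2)\<close>.
  Sums over the faces are taken over ordered triples of vertices, so that every face is counted
  six times.
\<close>

section \<open>Triangles in the plane\<close>

lemma inner_vec2: "a \<bullet> b = a$1 * b$1 + a$2 * b$2" for a b :: "real^2"
  by (simp add: inner_vec_def UNIV_2)

lemma signed_area_swap: "signed_area a c b = - signed_area a b c"
  by (simp add: signed_area_def field_simps)

lemma signed_area_rotate: "signed_area b c a = signed_area a b c"
  by (simp add: signed_area_def)

text \<open>With \<open>q\<close> the product of the edge lengths at \<open>c\<close>, the cosine is
  \<open>p / q\<close> and the sine is twice the area over \<open>q\<close>; in the cotangent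
  \<open>q\<close> cancels.\<close>

lemma cot_angle_at_mult_area2:
  assumes "signed_area a b c \<noteq> 0"
  shows "cot (angle_at c a b) * area2 a b c = (a - c) \<bullet> (b - c) / 2"
proof -
  define p q where "p = (a - c) \<bullet> (b - c)" and "q = norm (a - c) * norm (b - c)"
  \<comment> \<open>Lagrange's identity: twice the signed area is, up to sign, the cross product of
    the two edges at \<open>c\<close>.\<close>
  have lagrange: "q\<^sup>2 = p\<^sup>2 + (2 * signed_area a b c)\<^sup>2"
    unfolding p_def q_def power_mult_distrib power2_norm_eq_inner inner_vec2 signed_area_def
    by (simp add: power2_eq_square algebra_simps)
  then have "q \<noteq> 0"
    using assms by (metis add_nonneg_eq_0_iff mult_eq_0_iff power_eq_0_iff power_zero_numeral
        zero_le_power2 zero_neq_numeral)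
  then have q: "q > 0"
    by (simp add: q_def order.not_eq_order_implies_strict)
  have pq: "\<bar>p / q\<bar> \<le> 1"
    using q Cauchy_Schwarz_ineq2[of "a - c" "b - c"] by (simp add: p_def q_def)
  have "1 - (p / q)\<^sup>2 = (2 * signed_area a b c)\<^sup>2 / q\<^sup>2"
  proof -
    have "1 - (p / q)\<^sup>2 = (q\<^sup>2 - p\<^sup>2) / q\<^sup>2"
      using q by (simp add: power_divide diff_divide_distrib)
    then show ?thesis
      by (simp add: lagrange)
  qed
  then have "sqrt (1 - (p / q)\<^sup>2) = 2 * area2 a b c / q"
    using q by (simp add: real_sqrt_divide real_sqrt_mult area2_eq_abs_signed_area)
  moreover have "angle_at c a b = arccos (p / q)"
    by (simp add: angle_at_def p_def q_def)
  ultimately have "cot (angle_at c a b) = (p / q) / (2 * area2 a b c / q)"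
    using pq by (simp add: cot_def sin_arccos_abs cos_arccos_abs)
  then show ?thesis
    using q assms by (simp add: p_def area2_eq_abs_signed_area)
qed

text \<open>Replacing cotangent times area by inner products of edges leaves a polynomial identity.
  In the degenerate case the factor \<open>area2 a b c\<close> is 0, whatever the values of
  \<open>cot\<close>; so the energy is a polynomial everywhere.\<close>

lemma cot_sum_area2:
  "area2 a b c * (cot (angle_at c a b) * (norm (a - b))\<^sup>2 + cot (angle_at a b c) * (norm (b - c))\<^sup>2
     + cot (angle_at b c a) * (norm (c - a))\<^sup>2) = 4 * (signed_area a b c)\<^sup>2"
proof (cases "signed_area a b c = 0")
  case True
  then show ?thesis by (simp add: area2_eq_abs_signed_area)
next
  case False
  have [simp]: "area2 b c a = area2 a b c" "area2 c a b = area2 a b c"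
    by (simp_all add: area2_eq_abs_signed_area signed_area_def)
  have cots: "cot (angle_at c a b) * area2 a b c = (a - c) \<bullet> (b - c) / 2"
    "cot (angle_at a b c) * area2 a b c = (b - a) \<bullet> (c - a) / 2"
    "cot (angle_at b c a) * area2 a b c = (c - b) \<bullet> (a - b) / 2"
    using cot_angle_at_mult_area2[of a b c] cot_angle_at_mult_area2[of b c a]
      cot_angle_at_mult_area2[of c a b] False
    by (simp_all add: signed_area_rotate signed_area_rotate[of c a b])
  have "area2 a b c * (cot (angle_at c a b) * (norm (a - b))\<^sup>2
      + cot (angle_at a b c) * (norm (b - c))\<^sup>2 + cot (angle_at b c a) * (norm (c - a))\<^sup>2) =
      (a - c) \<bullet> (b - c) / 2 * (norm (a - b))\<^sup>2 + (b - a) \<bullet> (c - a) / 2 * (norm (b - c))\<^sup>2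
      + (c - b) \<bullet> (a - b) / 2 * (norm (c - a))\<^sup>2"
    unfolding cots[symmetric] by (simp add: algebra_simps)
  also have "\<dots> = 4 * (signed_area a b c)\<^sup>2"
    unfolding power2_norm_eq_inner inner_vec2 signed_area_def
    by (simp add: field_simps power2_eq_square)
  finally show ?thesis .
qed

text \<open>A set of \<open>k\<close> points has affine dimension at most \<open>k - 1\<close>, with
  equality only if they are independent. This recovers distinct, independent corners from a face
  given only as a convex hull.\<close>

lemma simplex_card_Suc:
  assumes "finite S" "card S \<le> Suc n" "int n simplex (convex hull S)"
  shows "\<not> affine_dependent S" "card S = Suc n"
proof -
  have "aff_dim S = int n"
    using aff_dim_simplex[OF assms(3)] by (simp add: aff_dim_convex_hull)
  then have "int n \<le> int (card S) - 1"
    using aff_dim_le_card[OF assms(1)] by simp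
  with assms(2) show "card S = Suc n" by simp
  with \<open>aff_dim S = int n\<close> show "\<not> affine_dependent S"
    using assms(1) by (simp add: affine_independent_iff_card)
qed

text \<open>A 2-simplex in the plane has full dimension, so its interior is its relative interior
  and nonempty, whereas a convex null set has empty interior.\<close>

lemma signed_area_nonzero:
  assumes "2 simplex (convex hull {a, b, c :: real^2})"
  shows "signed_area a b c \<noteq> 0"
proof
  let ?T = "convex hull {a, b, c}"
  assume "signed_area a b c = 0"
  then have "measure lebesgue ?T = 0"
    by (metis area2_def area2_eq_abs_signed_area abs_zero)
  moreover have "?T \<in> lmeasurable"
    by (simp add: lmeasurable_compact compact_convex_hull finite_imp_compact)
  ultimately have "negligible ?T"
    by (simp add: negligible_iff_measure)
  then have "interior ?T = {}"
    by (simp add: negligible_convex_interior)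
  moreover have "aff_dim ?T = int DIM(real^2)"
    using aff_dim_simplex[OF assms] by simp
  then have "affine hull ?T = UNIV"
    by (rule iffD1[OF aff_dim_eq_full])
  then have "rel_interior ?T = interior ?T"
    by (rule rel_interior_interior)
  ultimately show False
    by (metis convex_convex_hull convex_hull_eq_empty insert_not_empty rel_interior_eq_empty)
qed

section \<open>Sums over the faces\<close>

text \<open>The inverse rotation is two forward rotations, so \<open>P\<close> is closed under it
  too and rotation is a bijection of the index set.\<close>

lemma sum_triples_rotate:
  fixes g :: "'n::finite \<Rightarrow> 'n \<Rightarrow> 'n \<Rightarrow> real"
  assumes "\<And>i j k. P i j k \<Longrightarrow> P j k i"
  shows "(\<Sum>(i, j, k) | P i j k. g j k i) = (\<Sum>(i, j, k) | P i j k. g i j k)"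
  by (rule sum.reindex_bij_witness[where i = "\<lambda>(i, j, k). (k, i, j)" and j = "\<lambda>(i, j, k). (j, k, i)"])
     (auto intro: assms)

lemma sum_triples_swap:
  fixes g :: "'n::finite \<Rightarrow> 'n \<Rightarrow> 'n \<Rightarrow> real"
  assumes "\<And>i j k. P i j k \<Longrightarrow> P j i k"
  shows "(\<Sum>(i, j, k) | P i j k. g j i k) = (\<Sum>(i, j, k) | P i j k. g i j k)"
  by (rule sum.reindex_bij_witness[where i = "\<lambda>(i, j, k). (j, i, k)" and j = "\<lambda>(i, j, k). (j, i, k)"])
     (auto intro: assms)

lemma sum_pairs_swap:
  fixes g :: "'n::finite \<Rightarrow> 'n \<Rightarrow> real"
  assumes "\<And>j k. P j k \<Longrightarrow> P' k j" "\<And>j k. P' j k \<Longrightarrow> P k j"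
  shows "(\<Sum>(j, k) | P' j k. g k j) = (\<Sum>(j, k) | P j k. g j k)"
  by (rule sum.reindex_bij_witness[where i = "\<lambda>(i, j). (j, i)" and j = "\<lambda>(i, j). (j, i)"])
     (auto intro: assms)

lemma sum_triples_nested:
  fixes g :: "'n::finite \<Rightarrow> 'n \<Rightarrow> 'n \<Rightarrow> real"
  shows "(\<Sum>i\<in>UNIV. \<Sum>(j, k) | P i j k. g i j k) = (\<Sum>(i, j, k) | P i j k. g i j k)"
proof -
  have "{(i, j, k). P i j k} = Sigma UNIV (\<lambda>i. {(j, k). P i j k})"
    by auto
  then show ?thesis
    by (simp add: sum.Sigma split_def)
qed

lemma is_face_swap12: "is_face M v i j k \<Longrightarrow> is_face M v j i k"
  and is_face_swap23: "is_face M v i j k \<Longrightarrow> is_face M v i k j"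
  and is_face_rotate: "is_face M v i j k \<Longrightarrow> is_face M v j k i"
  by (simp_all add: is_face_def insert_commute)

lemma vimg_nth [simp]: "vimg F l $ 1 = fst F $ l" "vimg F l $ 2 = snd F $ l"
  by (simp_all add: vimg_def)

text \<open>A complex contains all faces of its simplices, among them the edges of its triangles.
  Hence the edge test in \<open>stretch_weight\<close> succeeds wherever a face contributes.\<close>

lemma is_face_edge:
  assumes M: "simplicial_surface M" and face: "is_face M v i j k"
  shows "i \<noteq> j" "convex hull {v i, v j} \<in> edges M"
proof -
  let ?S = "{v i, v j, v k}"
  have T: "convex hull ?S \<in> M" "2 simplex (convex hull ?S)"
    using face by (auto simp: is_face_def faces_def)
  have card: "card ?S \<le> Suc 2"
    by (simp add: card_insert_if)
  have indep: "\<not> affine_dependent ?S" and "card ?S = Suc 2"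
    using simplex_card_Suc[of ?S 2] card T(2) by auto
  then have vij: "v i \<noteq> v j"
    by (auto simp: card_insert_if split: if_splits)
  then show "i \<noteq> j" by auto
  have "convex hull {v i, v j} face_of convex hull ?S"
    unfolding face_of_convex_hull_affine_independent[OF indep]
    by (intro exI[of _ "{v i, v j}"]) auto
  then have "convex hull {v i, v j} \<in> M"
    using M T(1) unfolding simplicial_surface_def simplicial_complex_def by blast
  moreover have "1 simplex (convex hull {v i, v j})"
    unfolding simplex_def using vij indep
    by (intro exI[of _ "{v i, v j}"]) (auto simp: affine_independent_2)
  ultimately show "convex hull {v i, v j} \<in> edges M"
    by (simp add: edges_def)
qed

section \<open>Symmetries of areas, stretch factors and angles\<close>

lemma area3_swap12: "area3 b a c = area3 a b c"
  and area3_swap23: "area3 a c b = area3 a b c"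
proof -
  have "cross3 (a - b) (c - b) = - cross3 (b - a) (c - a)"
    by (simp add: cross3_simps)
  then show "area3 b a c = area3 a b c"
    by (simp add: area3_def)
  have "cross3 (c - a) (b - a) = - cross3 (b - a) (c - a)"
    by (rule cross_skew)
  then show "area3 a c b = area3 a b c"
    by (simp add: area3_def)
qed

lemma area3_rotate: "area3 b c a = area3 a b c"
  by (metis area3_swap12 area3_swap23)

lemma area2_swap12: "area2 b a c = area2 a b c"
  and area2_rotate: "area2 b c a = area2 a b c"
  by (simp_all add: area2_def insert_commute)

lemma stretch_swap12: "stretch v F j i k = stretch v F i j k"
  and stretch_rotate: "stretch v F j k i = stretch v F i j k"
  by (simp_all only: stretch_def area2_swap12 area2_rotate area3_swap12 area3_rotate)

lemma angle_at_commute: "angle_at c a b = angle_at c b a"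
  by (simp add: angle_at_def inner_commute mult.commute)

section \<open>The stretch energy and its gradient\<close>

lemma stretch_laplacian_mult_vec:
  assumes "simplicial_surface M"
  shows "(stretch_laplacian M v F *v x) $ i = 1/2 * (\<Sum>(j, k) | is_face M v i j k.
           cot (angle_at (vimg F k) (vimg F i) (vimg F j)) * stretch v F i j k * (x$i - x$j))"
proof -
  let ?c = "\<lambda>j k. cot (angle_at (vimg F k) (vimg F i) (vimg F j)) * stretch v F i j k"
  let ?W = "stretch_weight M v F i"
  \<comment> \<open>If the test in \<open>stretch_weight\<close> fails, the sum over
    \<open>k\<close> is empty by \<open>is_face_edge\<close>, so both branches have this
    form.\<close>
  have W: "?W j = - (1/2) * (\<Sum>k | is_face M v i j k. ?c j k)" for j
    using is_face_edge[OF assms, of v i j] by (auto simp: stretch_weight_def intro: sum.neutral)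
  have "(stretch_laplacian M v F *v x) $ i =
      (\<Sum>j\<in>UNIV. (if i = j then - (\<Sum>l\<in>UNIV - {i}. ?W l) else ?W j) * x$j)"
    by (simp add: matrix_vector_mult_def stretch_laplacian_def)
  also have "\<dots> = - (\<Sum>l\<in>UNIV - {i}. ?W l) * x$i + (\<Sum>j\<in>UNIV - {i}. ?W j * x$j)"
    by (subst sum.remove[of UNIV i]) (auto intro!: sum.cong)
  \<comment> \<open>The rows of the matrix sum to 0, which turns values into differences; the term
    at \<open>j = i\<close> then vanishes and can be put back.\<close>
  also have "\<dots> = (\<Sum>j\<in>UNIV - {i}. ?W j * (x$j - x$i))"
    by (simp add: sum_distrib_right sum_subtractf right_diff_distrib)
  also have "\<dots> = (\<Sum>j\<in>UNIV. ?W j * (x$j - x$i))"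
    by (subst sum.remove[of UNIV i]) auto
  also have "\<dots> = (\<Sum>j\<in>UNIV. \<Sum>k | is_face M v i j k. 1/2 * (?c j k * (x$i - x$j)))"
    unfolding W sum_distrib_left sum_distrib_right
    by (intro sum.cong refl) (simp add: field_simps)
  also have "\<dots> = (\<Sum>(j, k) \<in> Sigma UNIV (\<lambda>j. {k. is_face M v i j k}).
      1/2 * (?c j k * (x$i - x$j)))"
    by (simp add: sum.Sigma)
  also have "Sigma UNIV (\<lambda>j. {k. is_face M v i j k}) = {(j, k). is_face M v i j k}"
    by auto
  finally show ?thesis
    by (simp add: sum_distrib_left split_def)
qed

lemma stretch_energy_eq:
  assumes "simplicial_surface M"
  shows "stretch_energy M v F = 1/6 * (\<Sum>(i, j, k) | is_face M v i j k.
           (signed_area (vimg F i) (vimg F j) (vimg F k))\<^sup>2 / area3 (v i) (v j) (v k))"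
proof -
  let ?f = "vimg F"
  let ?P = "is_face M v"
  define c where "c i j k = cot (angle_at (?f k) (?f i) (?f j)) * stretch v F i j k" for i j k
  have c_swap: "c j i k = c i j k" for i j k
    by (simp add: c_def stretch_swap12 angle_at_commute)
  define g where "g i j k = c i j k * (norm (?f i - ?f j))\<^sup>2" for i j k
  have "fst F \<bullet> (stretch_laplacian M v F *v fst F) + snd F \<bullet> (stretch_laplacian M v F *v snd F)
      = 1/2 * (\<Sum>i\<in>UNIV. \<Sum>(j, k) | ?P i j k. c i j k * (?f i \<bullet> (?f i - ?f j)))"
    unfolding inner_vec_def stretch_laplacian_mult_vec[OF assms] UNIV_2 c_def
    by (simp add: sum.distrib[symmetric] sum_distrib_left split_def algebra_simps)
  also have "\<dots> = 1/2 * (\<Sum>(i, j, k) | ?P i j k. c i j k * (?f i \<bullet> (?f i - ?f j)))"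
    by (simp only: sum_triples_nested)
  \<comment> \<open>Averaging over the two ends of an edge produces the squared edge length in
    \<open>g\<close>.\<close>
  also have "\<dots> = 1/4 * ((\<Sum>(i, j, k) | ?P i j k. c i j k * (?f i \<bullet> (?f i - ?f j)))
      + (\<Sum>(i, j, k) | ?P i j k. c j i k * (?f j \<bullet> (?f j - ?f i))))"
    by (subst sum_triples_swap) (auto intro: is_face_swap12)
  also have "\<dots> = 1/4 * (\<Sum>(i, j, k) | ?P i j k. g i j k)"
    unfolding sum.distrib[symmetric] g_def
    by (intro arg_cong[of _ _ "\<lambda>x. 1/4 * x"] sum.cong)
       (auto simp: c_swap power2_norm_eq_inner inner_commute algebra_simps)
  \<comment> \<open>Averaging over the three rotations of a face brings its three cotangents
    together for \<open>cot_sum_area2\<close>.\<close>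
  also have "\<dots> = 1/12 * ((\<Sum>(i, j, k) | ?P i j k. g i j k) + (\<Sum>(i, j, k) | ?P i j k. g j k i)
      + (\<Sum>(i, j, k) | ?P i j k. g k i j))"
    using sum_triples_rotate[of ?P g] sum_triples_rotate[of ?P "\<lambda>i j k. g j k i"]
    by (simp add: is_face_rotate)
  also have "\<dots> = 1/12 * (\<Sum>(i, j, k) | ?P i j k.
      4 * ((signed_area (?f i) (?f j) (?f k))\<^sup>2 / area3 (v i) (v j) (v k)))"
  proof -
    have "g i j k + g j k i + g k i j =
        4 * ((signed_area (?f i) (?f j) (?f k))\<^sup>2 / area3 (v i) (v j) (v k))" for i j k
    proof -
      have "stretch v F k i j = stretch v F i j k" "stretch v F j k i = stretch v F i j k"
        by (metis stretch_rotate)+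
      then have "g i j k + g j k i + g k i j = area2 (?f i) (?f j) (?f k)
          * (cot (angle_at (?f k) (?f i) (?f j)) * (norm (?f i - ?f j))\<^sup>2
           + cot (angle_at (?f i) (?f j) (?f k)) * (norm (?f j - ?f k))\<^sup>2
           + cot (angle_at (?f j) (?f k) (?f i)) * (norm (?f k - ?f i))\<^sup>2) / area3 (v i) (v j) (v k)"
        by (simp add: g_def c_def stretch_def add_divide_distrib algebra_simps)
      then show ?thesis
        by (simp add: cot_sum_area2)
    qed
    then show ?thesis
      by (simp add: sum.distrib[symmetric] split_def)
  qed
  finally show ?thesis
    by (simp add: stretch_energy_def sum_distrib_left split_def)
qed

text \<open>The signed area takes the place of a choice of orientation: \<open>(j, k)\<close> and
  \<open>(k, j)\<close> both occur and contribute equally, hence 1/4 where \<open>h1\<close> and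
  \<open>h2\<close> have 1/2.\<close>

definition half_gradient ::
    "(real^3) set set \<Rightarrow> ('n::finite \<Rightarrow> real^3) \<Rightarrow> (real^'n) \<times> (real^'n) \<Rightarrow> (real^'n) \<times> (real^'n)" where
  "half_gradient M v F =
     ((\<chi> i. 1/4 * (\<Sum>(j, k) | is_face M v i j k.
        signed_area (vimg F i) (vimg F j) (vimg F k) / area3 (v i) (v j) (v k) * (snd F $ j - snd F $ k))),
      (\<chi> i. 1/4 * (\<Sum>(j, k) | is_face M v i j k.
        signed_area (vimg F i) (vimg F j) (vimg F k) / area3 (v i) (v j) (v k) * (fst F $ k - fst F $ j))))"

lemma stretch_energy_gradient:
  assumes "simplicial_surface M"
  shows "GDERIV (stretch_energy M v) F :> half_gradient M v F + half_gradient M v F"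
proof -
  let ?P = "is_face M v"
  define s where "s F i j k = signed_area (vimg F i) (vimg F j) (vimg F k)" for F :: "(real^'a) \<times> (real^'a)" and i j k
  define A where "A i j k = area3 (v i) (v j) (v k)" for i j k
  \<comment> \<open>The part of the differential of the signed area that comes from moving the first vertex;
    cyclic rotation gives the other two parts.\<close>
  define d where "d h i j k = 1/2 * (fst h $ i * (snd F $ j - snd F $ k) + snd h $ i * (fst F $ k - fst F $ j))"
    for h :: "(real^'a) \<times> (real^'a)" and i j k
  have A: "A j k i = A i j k" for i j k
    by (simp add: A_def area3_rotate)
  have s: "s F j k i = s F i j k" for i j k
    by (simp add: s_def signed_area_rotate)
  have dcoord: "((\<lambda>F. fst F $ l) has_derivative (\<lambda>h. fst h $ l)) (at F)"
    "((\<lambda>F. snd F $ l) has_derivative (\<lambda>h. snd h $ l)) (at F)" for l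
    by (intro bounded_linear_imp_has_derivative bounded_linear_compose[OF bounded_linear_vec_nth]
        bounded_linear_fst bounded_linear_snd)+
  have ds: "((\<lambda>F. s F i j k) has_derivative (\<lambda>h. d h i j k + d h j k i + d h k i j)) (at F)" for i j k
    unfolding s_def signed_area_def d_def vimg_nth
    by (auto intro!: derivative_eq_intros dcoord simp: fun_eq_iff field_simps)
  have "((\<lambda>F. 1/6 * (\<Sum>t | case t of (i, j, k) \<Rightarrow> ?P i j k.
          case t of (i, j, k) \<Rightarrow> (s F i j k)\<^sup>2 / A i j k)) has_derivative
        (\<lambda>h. 1/6 * (\<Sum>t | case t of (i, j, k) \<Rightarrow> ?P i j k.
          case t of (i, j, k) \<Rightarrow> 2 * s F i j k * (d h i j k + d h j k i + d h k i j) / A i j k))) (at F)"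
    by (intro has_derivative_mult_right has_derivative_sum)
       (auto intro!: derivative_eq_intros ds simp: fun_eq_iff split_def divide_inverse)
  then have deriv: "(stretch_energy M v has_derivative
        (\<lambda>h. 1/6 * (\<Sum>(i, j, k) | ?P i j k.
          2 * s F i j k * (d h i j k + d h j k i + d h k i j) / A i j k))) (at F)"
    unfolding s_def A_def using stretch_energy_eq[OF assms, of v] by presburger
  have "1/6 * (\<Sum>(i, j, k) | ?P i j k. 2 * s F i j k * (d h i j k + d h j k i + d h k i j) / A i j k)
      = h \<bullet> (half_gradient M v F + half_gradient M v F)" for h
  proof -
    define g where "g i j k = s F i j k / A i j k * d h i j k" for i j k
    have "1/6 * (\<Sum>(i, j, k) | ?P i j k. 2 * s F i j k * (d h i j k + d h j k i + d h k i j) / A i j k)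
       = 1/3 * (\<Sum>(i, j, k) | ?P i j k. g i j k + g j k i + g k i j)"
    proof -
      have "2 * s F i j k * (d h i j k + d h j k i + d h k i j) / A i j k
          = 2 * (g i j k + g j k i + g k i j)" for i j k
        using A[of k i j] A[of i j k] s[of k i j] s[of i j k]
        by (simp add: g_def add_divide_distrib algebra_simps)
      then show ?thesis
        unfolding sum_distrib_left by (intro sum.cong refl) (simp add: split_def)
    qed
    \<comment> \<open>The three rotated sums are equal, so only the motion of the first vertex
      remains.\<close>
    also have "\<dots> = (\<Sum>(i, j, k) | ?P i j k. g i j k)"
      using sum_triples_rotate[of ?P g] sum_triples_rotate[of ?P "\<lambda>i j k. g j k i"]
      by (simp add: is_face_rotate split_def sum.distrib)
    also have "\<dots> = (\<Sum>i\<in>UNIV. \<Sum>(j, k) | ?P i j k. g i j k)"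
      by (simp only: sum_triples_nested)
    also have "\<dots> = h \<bullet> (half_gradient M v F + half_gradient M v F)"
      unfolding half_gradient_def g_def d_def s_def A_def
      by (cases h) (simp add: inner_vec_def sum.distrib[symmetric] sum_distrib_left split_def
          algebra_simps add_divide_distrib diff_divide_distrib)
    finally show ?thesis .
  qed
  with deriv show ?thesis
    by (simp add: gderiv_def)
qed

text \<open>Exchanging \<open>j\<close> and \<open>k\<close> matches the clockwise pairs with the
  counterclockwise ones and preserves the summand, as signed area and difference both change
  sign.\<close>

lemma sum_counterclockwise:
  fixes y :: "'n::finite \<Rightarrow> real"
  assumes nz: "\<And>j k. is_face M v i j k \<Longrightarrow> signed_area (vimg F i) (vimg F j) (vimg F k) \<noteq> 0"
  shows "(\<Sum>(j, k) | is_face M v i j k.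
      signed_area (vimg F i) (vimg F j) (vimg F k) / area3 (v i) (v j) (v k) * (y j - y k)) =
    2 * (\<Sum>(j, k) | is_face M v i j k \<and> counterclockwise (vimg F i) (vimg F j) (vimg F k).
      stretch v F i j k * (y j - y k))"
proof -
  let ?s = "\<lambda>j k. signed_area (vimg F i) (vimg F j) (vimg F k)"
  let ?g = "\<lambda>j k. ?s j k / area3 (v i) (v j) (v k) * (y j - y k)"
  let ?P = "\<lambda>j k. is_face M v i j k \<and> ?s j k > 0"
  let ?N = "\<lambda>j k. is_face M v i j k \<and> ?s j k < 0"
  have "{(j, k). is_face M v i j k} = {(j, k). ?P j k} \<union> {(j, k). ?N j k}"
    using nz by fastforce
  then have "(\<Sum>(j, k) | is_face M v i j k. ?g j k) =
      (\<Sum>(j, k) | ?P j k. ?g j k) + (\<Sum>(j, k) | ?N j k. ?g j k)"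
    by (auto intro: sum.union_disjoint)
  also have "(\<Sum>(j, k) | ?N j k. ?g j k) = (\<Sum>(j, k) | ?N j k. ?g k j)"
  proof (intro sum.cong refl, clarify)
    fix j k
    show "?g j k = ?g k j"
      unfolding signed_area_swap[of "vimg F i" "vimg F k"] area3_swap23[of "v i" "v k"]
      by (simp add: algebra_simps diff_divide_distrib)
  qed
  also have "\<dots> = (\<Sum>(j, k) | ?P j k. ?g j k)"
  proof (rule sum_pairs_swap)
    fix j k
    have "?s k j = - ?s j k" by (rule signed_area_swap)
    then show "?P j k \<Longrightarrow> ?N k j" "?N j k \<Longrightarrow> ?P k j"
      by (simp_all add: is_face_swap23)
  qed
  also have "(\<Sum>(j, k) | ?P j k. ?g j k) + (\<Sum>(j, k) | ?P j k. ?g j k) = 2 * (\<Sum>(j, k) | ?P j k. ?g j k)"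
    by simp
  also have "(\<Sum>(j, k) | ?P j k. ?g j k) =
      (\<Sum>(j, k) | is_face M v i j k \<and> counterclockwise (vimg F i) (vimg F j) (vimg F k).
        stretch v F i j k * (y j - y k))"
    using nz by (intro sum.cong) (auto simp: counterclockwise_iff stretch_def area2_eq_abs_signed_area)
  finally show ?thesis .
qed

lemma h1_h2_eq_half_gradient:
  assumes nz: "\<And>i j k. is_face M v i j k \<Longrightarrow> signed_area (vimg F i) (vimg F j) (vimg F k) \<noteq> 0"
  shows "(h1 M v F, h2 M v F) = half_gradient M v F"
  \<comment> \<open>The minus sign in the second instance accounts for the reversed difference in
    \<open>h2\<close>.\<close>
  using sum_counterclockwise[OF nz, where y = "($) (snd F)"]
    sum_counterclockwise[OF nz, where y = "\<lambda>j. - fst F $ j"]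
  by (simp add: h1_def h2_def half_gradient_def vec_eq_iff)

lemma laplacian_eq_half_gradient:
  assumes M: "simplicial_surface M"
    and nz: "\<And>i j k. is_face M v i j k \<Longrightarrow> signed_area (vimg F i) (vimg F j) (vimg F k) \<noteq> 0"
  shows "(stretch_laplacian M v F *v fst F, stretch_laplacian M v F *v snd F) = half_gradient M v F"
proof -
  let ?f = "vimg F"
  let ?s = "\<lambda>i j k. signed_area (?f i) (?f j) (?f k)"
  let ?A = "\<lambda>i j k. area3 (v i) (v j) (v k)"
  let ?p = "\<lambda>i j k. (?f i - ?f k) \<bullet> (?f j - ?f k)"
  have L: "(stretch_laplacian M v F *v x) $ i = 1/4 * (\<Sum>(j, k) | is_face M v i j k.
      (?p i j k * (x$i - x$j) + ?p i k j * (x$i - x$k)) / (2 * ?A i j k))" for x i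
  proof -
    let ?g = "\<lambda>j k. ?p i j k * (x$i - x$j) / (2 * ?A i j k)"
    have "(stretch_laplacian M v F *v x) $ i = 1/2 * (\<Sum>(j, k) | is_face M v i j k. ?g j k)"
      unfolding stretch_laplacian_mult_vec[OF M]
    proof (intro arg_cong[of _ _ "\<lambda>x. 1/2 * x"] sum.cong refl, clarify)
      fix j k assume "is_face M v i j k"
      then have "cot (angle_at (?f k) (?f i) (?f j)) * area2 (?f i) (?f j) (?f k) = ?p i j k / 2"
        by (intro cot_angle_at_mult_area2 nz)
      moreover have "cot (angle_at (?f k) (?f i) (?f j)) * stretch v F i j k * (x$i - x$j) =
          cot (angle_at (?f k) (?f i) (?f j)) * area2 (?f i) (?f j) (?f k) * (x$i - x$j) / ?A i j k"
        by (simp add: stretch_def)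
      ultimately show "cot (angle_at (?f k) (?f i) (?f j)) * stretch v F i j k * (x$i - x$j) = ?g j k"
        by (simp only: times_divide_eq_left divide_divide_eq_left)
    qed
    \<comment> \<open>Averaging over both orders of \<open>j\<close> and \<open>k\<close> pairs the
      two edges of a face that meet at vertex \<open>i\<close>.\<close>
    also have "\<dots> = 1/4 * ((\<Sum>(j, k) | is_face M v i j k. ?g j k) + (\<Sum>(j, k) | is_face M v i j k. ?g k j))"
      by (subst sum_pairs_swap) (auto intro: is_face_swap23)
    finally show ?thesis
      by (simp add: sum.distrib[symmetric] split_def add_divide_distrib area3_swap23)
  qed
  \<comment> \<open>The left sides here and in the next fact are the coordinates of the altitude
    vector ending at vertex \<open>i\<close>, times the squared length of the opposite edge; the
    right sides are that edge turned by a right angle, times twice the signed area.\<close>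
  have 1: "?p i j k * (fst F$i - fst F$j) + ?p i k j * (fst F$i - fst F$k) =
      2 * ?s i j k * (snd F$j - snd F$k)" for i j k
    by (simp add: inner_vec2 signed_area_def algebra_simps)
  have 2: "?p i j k * (snd F$i - snd F$j) + ?p i k j * (snd F$i - snd F$k) =
      2 * ?s i j k * (fst F$k - fst F$j)" for i j k
    by (simp add: inner_vec2 signed_area_def algebra_simps)
  show ?thesis
    by (simp add: half_gradient_def vec_eq_iff L 1 2)
qed

theorem theorem1:
  fixes M :: "(real^3) set set"
    and v :: "'n::finite \<Rightarrow> real^3"
    and f :: "real^3 \<Rightarrow> real^2"
  assumes "simplicial_surface M"
    and "bij_betw v UNIV (vertices M)"
    and "simplicial_map M f"
    and "\<forall>\<tau>\<in>faces M. 2 simplex (f ` \<tau>)"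
  shows "GDERIV (stretch_energy M v) (coords v f) :>
           (stretch_laplacian M v (coords v f) *v fst (coords v f) + h1 M v (coords v f),
            stretch_laplacian M v (coords v f) *v snd (coords v f) + h2 M v (coords v f))"
proof -
  let ?F = "coords v f"
  have nz: "signed_area (vimg ?F i) (vimg ?F j) (vimg ?F k) \<noteq> 0" if "is_face M v i j k" for i j k
    using assms(4) that simplicial_map_image_face[OF assms(3) that]
    by (metis is_face_def signed_area_nonzero vimg_coords)
  show ?thesis
    using stretch_energy_gradient[OF assms(1), of v ?F]
      laplacian_eq_half_gradient[OF assms(1) nz] h1_h2_eq_half_gradient[OF nz]
    by (metis add_Pair)
qed

end
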